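(* Let $\tau\ge1$, $n\ge1$ be integers, $T:=\tau+n$, let $F_0,F_1$ be continuous distributions on $\mathbb R$, and suppose that $\Delta:=|\theta-\tfrac12|>0$, where $\theta:=\mathbb P(X_0>X_1')$ for independent $X_0\sim F_0$, $X_1'\sim F_1$. Let $(B_t)_{1\le t\le T}$ be a deterministic positive boundary, let $M^\star_t$ be the oracle conformal likelihood-ratio process, and let $D^\star:=\inf\{1\le t\le T:M_t^\star>B_t\}$ ($\inf\varnothing=\infty$). Define $r_{\tau,n}:=\dfrac{\tau n}{\tau+n}$ and, for $0<\lambda<1$, $$c_\lambda:=\frac{2\lambda(1-\lambda)}{(\sqrt\lambda+\sqrt{1-\lambda})^2}.$$ Then $$\mathbb P_\tau(D^\star>T)\le\inf_{0<\lambda<1}2\exp\{\lambda\log B_T-c_\lambda\Delta^2r_{\tau,n}\}.$$ In particular, taking $\lambda=1/2$ gives $$\mathbb P_\tau(D^\star>T)\le 2B_T^{1/2}\exp\Big\{-\frac{\Delta^2}{4}\frac{\tau n}{\tau+n}\Big\}.$$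
   Context: Change-point model (law $\mathbb P_\tau$): $X_1,\ldots,X_\tau$ are i.i.d. from $F_0$, $X_{\tau+1},X_{\tau+2},\ldots$ are i.i.d. from $F_1$, the two samples are independent, and $U_1,U_2,\ldots$ are i.i.d. $\mathrm{Unif}(0,1)$, independent of the $X$'s. The smoothed conformal $p$-values are $$p_t=\frac{\sum_{r=1}^{t-1}\mathbf 1\{X_r>X_t\}+U_t}{t},\qquad t\ge1.$$ For $1\le t\le T$, $P_t$ is the joint law of $(p_1,\ldots,p_t)$ under $\mathbb P_\tau$, $Q_t:=\mathrm{Unif}(0,1)^{\otimes t}$, and $q_t(u\mid p_{1:t-1})$ is the conditional density of $p_t$ given $p_1,\ldots,p_{t-1}$ under $\mathbb P_\tau$. The oracle conformal likelihood-ratio process is $M_0^\star=1$, $M_t^\star:=\prod_{s=1}^tq_s(p_s\mid p_{1:s-1})$, i.e. $M_t^\star=\frac{dP_t}{dQ_t}(p_1,\ldots,p_t)$. *)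

theory Defs
  imports "HOL-Probability.Probability"
begin

text \<open>Time is indexed from 1, as in the model; the variables with index 0 carry no assumption
  and are never used. Mutual independence of all the X's and all the U's is stated on the sum
  type of the two index sets.\<close>

locale change_point_model = prob_space M
  for M :: "'a measure" and F0 F1 :: "real measure" and \<tau> :: nat
    and X U :: "nat \<Rightarrow> 'a \<Rightarrow> real" +
  assumes indep: "indep_vars (\<lambda>_. borel) (case_sum X U) (Inl ` {1..} \<union> Inr ` {1..})"
    and pre_change: "\<And>t. 1 \<le> t \<Longrightarrow> t \<le> \<tau> \<Longrightarrow> distr M borel (X t) = F0"
    and post_change: "\<And>t. \<tau> < t \<Longrightarrow> distr M borel (X t) = F1"
    and uniform: "\<And>t. 1 \<le> t \<Longrightarrow> distr M borel (U t) = uniform_measure lborel {0<..<1}"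

definition continuous_distribution :: "real measure \<Rightarrow> bool" where
  "continuous_distribution F \<longleftrightarrow> real_distribution F \<and> continuous_on UNIV (cdf F)"

definition theta :: "real measure \<Rightarrow> real measure \<Rightarrow> real" where
  "theta F0 F1 = measure (F0 \<Otimes>\<^sub>M F1) {(x, y). x > y}"

definition pval :: "(nat \<Rightarrow> 'a \<Rightarrow> real) \<Rightarrow> (nat \<Rightarrow> 'a \<Rightarrow> real) \<Rightarrow> nat \<Rightarrow> 'a \<Rightarrow> real" where
  "pval X U t \<omega> = ((\<Sum>r\<in>{1..<t}. of_bool (X r \<omega> > X t \<omega>)) + U t \<omega>) / real t"

definition pvals_before :: "(nat \<Rightarrow> 'a \<Rightarrow> real) \<Rightarrow> (nat \<Rightarrow> 'a \<Rightarrow> real) \<Rightarrow> nat \<Rightarrow> 'a \<Rightarrow> (nat \<Rightarrow> real)" where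
  "pvals_before X U t \<omega> = (\<lambda>s\<in>{1..<t}. pval X U s \<omega>)"

text \<open>A version of the conditional (Lebesgue) density of the real random variable Z given the
  random variable Y with values in N: the function q with
  P(Y \<in> A, Z \<in> B) = \<integral> over y in A of (\<integral> over u in B of q(y, u) du), integrated against
  the law of Y, that is, the density of the joint law of (Y, Z) with respect to
  (law of Y) \<Otimes> Lebesgue. It is determined up to null sets of that product.\<close>

definition cond_density ::
    "'a measure \<Rightarrow> 'b measure \<Rightarrow> ('a \<Rightarrow> 'b) \<Rightarrow> ('a \<Rightarrow> real) \<Rightarrow> real \<Rightarrow> 'b \<Rightarrow> ennreal" where
  "cond_density M N Y Z u y =
     RN_deriv (distr M N Y \<Otimes>\<^sub>M lborel) (distr M (N \<Otimes>\<^sub>M lborel) (\<lambda>\<omega>. (Y \<omega>, Z \<omega>))) (y, u)"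

definition pval_density ::
    "'a measure \<Rightarrow> (nat \<Rightarrow> 'a \<Rightarrow> real) \<Rightarrow> (nat \<Rightarrow> 'a \<Rightarrow> real) \<Rightarrow> nat \<Rightarrow> real \<Rightarrow> (nat \<Rightarrow> real) \<Rightarrow> ennreal" where
  "pval_density M X U t =
     cond_density M (\<Pi>\<^sub>M s\<in>{1..<t}. borel) (pvals_before X U t) (pval X U t)"

definition oracle_lr ::
    "'a measure \<Rightarrow> (nat \<Rightarrow> 'a \<Rightarrow> real) \<Rightarrow> (nat \<Rightarrow> 'a \<Rightarrow> real) \<Rightarrow> nat \<Rightarrow> 'a \<Rightarrow> ennreal" where
  "oracle_lr M X U t \<omega> =
     (\<Prod>s\<in>{1..t}. pval_density M X U s (pval X U s \<omega>) (pvals_before X U s \<omega>))"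

text \<open>In \<^typ>\<open>enat\<close> the infimum of the empty set is \<open>\<infinity>\<close>.\<close>

definition detection_time ::
    "'a measure \<Rightarrow> (nat \<Rightarrow> 'a \<Rightarrow> real) \<Rightarrow> (nat \<Rightarrow> 'a \<Rightarrow> real) \<Rightarrow> nat \<Rightarrow> (nat \<Rightarrow> real) \<Rightarrow> 'a \<Rightarrow> enat" where
  "detection_time M X U T B \<omega> =
     Inf (enat ` {t\<in>{1..T}. oracle_lr M X U t \<omega> > ennreal (B t)})"

definition r_eff :: "nat \<Rightarrow> nat \<Rightarrow> real" where
  "r_eff \<tau> n = real \<tau> * real n / (real \<tau> + real n)"

definition c_const :: "real \<Rightarrow> real" where
  "c_const l = 2 * l * (1 - l) / (sqrt l + sqrt (1 - l))\<^sup>2"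

end

theory Submission
  imports Defs "HOL-Combinatorics.Permutations"
begin

text \<open>The oracle likelihood-ratio process is the density of the law of the p-values with respect to
  Lebesgue measure, so a Neyman-Pearson argument with a well-chosen test applies: if a test based on
  the p-values has error probabilities \<open>\<alpha>\<close> (under uniform p-values) and \<open>\<beta>\<close> (under the change-point
  model), then \<open>M\<^sub>T \<le> b\<close> has probability at most
  \<open>min(1, b \<alpha>) + min(b, \<beta>) \<le> b\<^sup>\<lambda> (\<alpha>\<^sup>\<lambda> + \<beta>\<^bsup>1-\<lambda>\<^esup>)\<close>.
  Almost surely the p-values determine the relative order of the observations. The test counts how
  often \<open>X\<^sub>i > X\<^bsub>\<tau>+i\<^esub>\<close> among \<open>m = min(\<tau>, n)\<close> disjoint pairs. Under the change-point model these
  comparisons are independent with mean \<open>\<theta>\<close>; uniform p-values amount to a uniformly random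
  permutation, under which they are independent fair coin flips. Hoeffding's bound in both cases
  suffices, because \<open>\<tau> n / (\<tau> + n) \<le> m\<close>.\<close>

subsection \<open>Paired comparisons in random permutations\<close>

text \<open>Comparisons are centred: a fair coin gives each summand mean zero. The flag
  \<open>d\<close> selects the outcome that counts as positive, so the drift under the change can be
  taken nonnegative. The value type is generic because the score is applied to permutations and to
  real observations.\<close>

definition paired_score :: "bool \<Rightarrow> nat \<Rightarrow> nat \<Rightarrow> (nat \<Rightarrow> 'b::linorder) \<Rightarrow> real" where
  "paired_score d \<tau> m x = (\<Sum>i\<in>{1..m}. if (x i > x (\<tau> + i)) = d then 1 / 2 else - 1 / 2)"

text \<open>Swapping the values at the last pair of positions flips its comparison and keeps all others.\<close>

lemma sum_exp_paired_score_permutations: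
  assumes "m \<le> \<tau>" "\<tau> + m \<le> T"
  shows "(\<Sum>\<sigma> | \<sigma> permutes {1..T}. exp (s * paired_score d \<tau> m \<sigma>)) = fact T * cosh (s / 2) ^ m"
  using assms
proof (induction m)
  case 0
  then show ?case by (simp add: paired_score_def card_permutations)
next
  case (Suc m)
  let ?P = "{\<sigma>. \<sigma> permutes {1..T}}"
  let ?\<pi> = "Transposition.transpose (Suc m) (\<tau> + Suc m)"
  let ?z = "\<lambda>\<sigma>::nat \<Rightarrow> nat. if (\<sigma> (Suc m) > \<sigma> (\<tau> + Suc m)) = d then 1 / 2 else - 1 / 2 :: real"
  have \<pi>: "?\<pi> permutes {1..T}"
    using Suc.prems by (intro permutes_swap_id) auto
  have score: "paired_score d \<tau> (Suc m) \<sigma> = ?z \<sigma> + paired_score d \<tau> m \<sigma>" for \<sigma> :: "nat \<Rightarrow> nat"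
    by (simp add: paired_score_def)
  have flip: "paired_score d \<tau> (Suc m) (\<sigma> \<circ> ?\<pi>) = - ?z \<sigma> + paired_score d \<tau> m \<sigma>"
    if "\<sigma> permutes {1..T}" for \<sigma>
  proof -
    have "\<sigma> (Suc m) \<noteq> \<sigma> (\<tau> + Suc m)"
      using permutes_inj[OF that] Suc.prems by (auto dest!: injD)
    hence "?z (\<sigma> \<circ> ?\<pi>) = - ?z \<sigma>"
      by auto
    moreover have "paired_score d \<tau> m (\<sigma> \<circ> ?\<pi>) = paired_score d \<tau> m \<sigma>"
      unfolding paired_score_def using Suc.prems
      by (intro sum.cong) auto
    ultimately show ?thesis
      by (simp only: score)
  qed
  have "(\<Sum>\<sigma>\<in>?P. exp (s * paired_score d \<tau> (Suc m) \<sigma>)) =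
        (\<Sum>\<sigma>\<in>?P. exp (s * paired_score d \<tau> (Suc m) (\<sigma> \<circ> ?\<pi>)))"
    by (rule sum_permutations_compose_right[OF \<pi>])
  also have "\<dots> = (\<Sum>\<sigma>\<in>?P. exp (s * (- ?z \<sigma> + paired_score d \<tau> m \<sigma>)))"
    by (intro sum.cong refl) (simp only: flip mem_Collect_eq)
  finally have "2 * (\<Sum>\<sigma>\<in>?P. exp (s * paired_score d \<tau> (Suc m) \<sigma>)) =
      (\<Sum>\<sigma>\<in>?P. exp (s * (?z \<sigma> + paired_score d \<tau> m \<sigma>)) + exp (s * (- ?z \<sigma> + paired_score d \<tau> m \<sigma>)))"
    by (simp add: sum.distrib score)
  also have "\<dots> = (\<Sum>\<sigma>\<in>?P. 2 * cosh (s / 2) * exp (s * paired_score d \<tau> m \<sigma>))"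
    by (intro sum.cong) (auto simp: cosh_def exp_add exp_minus field_simps exp_diff)
  also have "\<dots> = 2 * cosh (s / 2) * (fact T * cosh (s / 2) ^ m)"
    using Suc by (simp flip: sum_distrib_left)
  finally show ?case by simp
qed

text \<open>The left side is the moment generating function of a fair sign of size 1/2, so this is
  Hoeffding's lemma with success probability 1/2.\<close>

lemma cosh_half_le_exp: "cosh (s / 2) \<le> exp (s\<^sup>2 / 8)" if "s \<ge> 0" for s :: real
proof -
  have "- s * (1 / 2) + ln (1 + 1 / 2 * (exp s - 1)) \<le> s\<^sup>2 / 8"
    using that by (intro Hoeffdings_lemma_aux) auto
  hence "exp (- s * (1 / 2) + ln (1 + 1 / 2 * (exp s - 1))) \<le> exp (s\<^sup>2 / 8)"
    by simp
  moreover have "exp (- s * (1 / 2) + ln (1 + 1 / 2 * (exp s - 1))) = cosh (s / 2)"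
  proof -
    have "1 + 1 / 2 * (exp s - 1) > 0"
      using exp_gt_zero[of s] by (simp add: field_simps add_pos_pos del: exp_gt_zero)
    moreover have "exp s = exp (s / 2) * exp (s / 2)"
      by (simp flip: exp_add)
    ultimately show ?thesis
      by (subst exp_add) (simp add: exp_minus cosh_def field_simps)
  qed
  ultimately show ?thesis by (simp only:)
qed

text \<open>Chernoff's method for a uniform random permutation, whose exponential moment is that of
  \<open>m\<close> independent fair signs.\<close>

lemma card_permutations_paired_score_ge:
  assumes "m \<le> \<tau>" "\<tau> + m \<le> T" "\<epsilon> \<ge> 0"
  shows "real (card {\<sigma>. \<sigma> permutes {1..T} \<and> paired_score d \<tau> m \<sigma> \<ge> real m * \<epsilon>})
           \<le> fact T * exp (- 2 * \<epsilon>\<^sup>2 * real m)"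
proof -
  let ?G = "{\<sigma>. \<sigma> permutes {1..T} \<and> paired_score d \<tau> m \<sigma> \<ge> real m * \<epsilon>}"
  have fin: "finite {\<sigma>. \<sigma> permutes {1..T}}"
    by (simp add: finite_permutations)
  \<comment> \<open>The parameter s = 4 \<epsilon> minimizes s^2/8 - s \<epsilon>, with minimum -2
    \<epsilon>^2.\<close>
  have "real (card ?G) * exp (4 * \<epsilon> * (real m * \<epsilon>)) = (\<Sum>\<sigma>\<in>?G. exp (4 * \<epsilon> * (real m * \<epsilon>)))"
    by simp
  also have "\<dots> \<le> (\<Sum>\<sigma>\<in>?G. exp (4 * \<epsilon> * paired_score d \<tau> m \<sigma>))"
    using assms(3) by (intro sum_mono) (auto intro: mult_left_mono)
  also have "\<dots> \<le> (\<Sum>\<sigma> | \<sigma> permutes {1..T}. exp (4 * \<epsilon> * paired_score d \<tau> m \<sigma>))"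
    using fin by (intro sum_mono2) auto
  also have "\<dots> = fact T * cosh (4 * \<epsilon> / 2) ^ m"
    by (rule sum_exp_paired_score_permutations[OF assms(1,2)])
  also have "\<dots> \<le> fact T * exp ((4 * \<epsilon>)\<^sup>2 / 8) ^ m"
    using assms(3) by (intro mult_left_mono power_mono cosh_half_le_exp) auto
  also have "\<dots> = fact T * exp (- 2 * \<epsilon>\<^sup>2 * real m) * exp (4 * \<epsilon> * (real m * \<epsilon>))"
    by (simp flip: exp_of_nat_mult exp_add add: power2_eq_square algebra_simps)
  finally show ?thesis by simp
qed

text \<open>Ranks count values up to and including \<open>x t\<close>, so they start at 1; outside
  \<open>{1..T}\<close> the map is the identity, as \<open>permutes\<close> demands.\<close>

definition rank_perm :: "nat \<Rightarrow> (nat \<Rightarrow> real) \<Rightarrow> nat \<Rightarrow> nat" where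
  "rank_perm T x t = (if t \<in> {1..T} then card {s\<in>{1..T}. x s \<le> x t} else t)"

lemma rank_perm_less_iff:
  assumes "s \<in> {1..T}" "t \<in> {1..T}"
  shows "rank_perm T x s < rank_perm T x t \<longleftrightarrow> x s < x t"
proof
  assume "x s < x t"
  hence "{r\<in>{1..T}. x r \<le> x s} \<subseteq> {r\<in>{1..T}. x r \<le> x t}"
    "t \<in> {r\<in>{1..T}. x r \<le> x t}" "t \<notin> {r\<in>{1..T}. x r \<le> x s}"
    using assms by auto
  hence "{r\<in>{1..T}. x r \<le> x s} \<subset> {r\<in>{1..T}. x r \<le> x t}"
    by blast
  hence "card {r\<in>{1..T}. x r \<le> x s} < card {r\<in>{1..T}. x r \<le> x t}"
    by (intro psubset_card_mono) auto
  thus "rank_perm T x s < rank_perm T x t"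
    using assms by (simp only: rank_perm_def if_True)
next
  assume *: "rank_perm T x s < rank_perm T x t"
  show "x s < x t"
  proof (rule ccontr)
    assume "\<not> x s < x t"
    hence "{r\<in>{1..T}. x r \<le> x t} \<subseteq> {r\<in>{1..T}. x r \<le> x s}"
      by auto
    hence "card {r\<in>{1..T}. x r \<le> x t} \<le> card {r\<in>{1..T}. x r \<le> x s}"
      by (intro card_mono) auto
    hence "rank_perm T x t \<le> rank_perm T x s"
      using assms by (simp only: rank_perm_def if_True)
    with * show False by simp
  qed
qed

lemma rank_perm_permutes:
  assumes "inj_on x {1..T}"
  shows "rank_perm T x permutes {1..T}"
proof (rule bij_imp_permutes)
  have inj: "inj_on (rank_perm T x) {1..T}"
  proof (rule inj_onI)
    fix s t assume st: "s \<in> {1..T}" "t \<in> {1..T}" "rank_perm T x s = rank_perm T x t"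
    hence "x s = x t"
      using rank_perm_less_iff[of s T t x] rank_perm_less_iff[of t T s x] by auto
    thus "s = t" using assms st by (auto dest: inj_onD)
  qed
  have "rank_perm T x ` {1..T} \<subseteq> {1..T}"
  proof safe
    fix t assume t: "t \<in> {1..T}"
    have "card {s\<in>{1..T}. x s \<le> x t} \<le> card {1..T}"
      by (intro card_mono) auto
    moreover have "card {s\<in>{1..T}. x s \<le> x t} > 0"
      using t by (auto simp: card_gt_0_iff)
    ultimately show "rank_perm T x t \<in> {1..T}"
      using t by (simp add: rank_perm_def)
  qed
  with inj show "bij_betw (rank_perm T x) {1..T} {1..T}"
    by (simp add: bij_betw_def endo_inj_surj)
qed (auto simp: rank_perm_def)

text \<open>The score depends only on relative order, so a test on real observations becomes a test
  on permutations.\<close>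

lemma paired_score_rank_perm:
  assumes "m \<le> \<tau>" "\<tau> + m \<le> T"
  shows "paired_score d \<tau> m (rank_perm T x) = paired_score d \<tau> m x"
proof -
  have "rank_perm T x i > rank_perm T x (\<tau> + i) \<longleftrightarrow> x i > x (\<tau> + i)" if "i \<in> {1..m}" for i
    using that assms by (intro rank_perm_less_iff) auto
  thus ?thesis
    unfolding paired_score_def by (intro sum.cong) (simp_all only:)
qed

text \<open>The region containing \<open>p\<^sub>1, \<dots>, p\<^sub>T\<close> when the observations are ordered like \<open>x\<close>.\<close>

definition pval_box :: "nat \<Rightarrow> (nat \<Rightarrow> 'b::linorder) \<Rightarrow> (nat \<Rightarrow> real) set" where
  "pval_box T x = (\<Pi>\<^sub>E t\<in>{1..<Suc T}.
     {real (card {r\<in>{1..<t}. x r > x t}) / real t <..< (real (card {r\<in>{1..<t}. x r > x t}) + 1) / real t})"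

text \<open>Only the order of \<open>x\<close> enters the box, so finitely many boxes, indexed by
  permutations, suffice.\<close>

lemma pval_box_rank_perm: "pval_box T (rank_perm T x) = pval_box T x"
proof -
  have "{r\<in>{1..<t}. rank_perm T x r > rank_perm T x t} = {r\<in>{1..<t}. x r > x t}"
    if "t \<in> {1..<Suc T}" for t
    using that by (intro Collect_cong conj_cong refl rank_perm_less_iff) auto
  thus ?thesis
    unfolding pval_box_def by (intro PiE_cong) (simp only:)
qed

lemma pval_box_sets [measurable]: "pval_box T x \<in> sets (\<Pi>\<^sub>M t\<in>{1..<Suc T}. lborel)"
  unfolding pval_box_def by (intro sets_PiM_I_finite) auto

text \<open>The side at \<open>t\<close> has length 1/t. The volume is the same for every order,
  which is how uniform p-values correspond to a uniform permutation.\<close>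

lemma emeasure_pval_box: "emeasure (\<Pi>\<^sub>M t\<in>{1..<Suc T}. lborel) (pval_box T x) = ennreal (1 / fact T)"
proof -
  interpret product_sigma_finite "\<lambda>_::nat. lborel :: real measure" ..
  have "emeasure (\<Pi>\<^sub>M t\<in>{1..<Suc T}. lborel) (pval_box T x) = (\<Prod>t\<in>{1..<Suc T}. ennreal (1 / real t))"
    unfolding pval_box_def
    by (subst emeasure_PiM) (auto intro!: prod.cong simp: divide_right_mono simp flip: diff_divide_distrib)
  also have "\<dots> = ennreal (\<Prod>t\<in>{1..<Suc T}. 1 / real t)"
    by (intro prod_ennreal) auto
  also have "(\<Prod>t\<in>{1..<Suc T}. 1 / real t) = 1 / fact T"
    by (simp add: prod_dividef fact_prod atLeastLessThanSuc_atLeastAtMost)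
  finally show ?thesis .
qed

text \<open>Write p as p^(1-l) p^l and bound the factors separately. This merges two bounds on one
  probability into the mixed exponents of the final estimate.\<close>

lemma le_powr_mult_powr:
  fixes p x y l :: real
  assumes "0 \<le> p" "p \<le> x" "p \<le> y" "0 \<le> l" "l \<le> 1"
  shows "p \<le> x powr (1 - l) * y powr l"
proof (cases "p = 0")
  case False
  hence "p = p powr (1 - l) * p powr l"
    using assms by (simp flip: powr_add)
  also have "\<dots> \<le> x powr (1 - l) * y powr l"
    using assms by (intro mult_mono powr_mono2) auto
  finally show ?thesis .
qed simp

text \<open>\<open>r_eff\<close> is minimum times maximum over the sum, and the maximum is at most
  the sum.\<close>

lemma r_eff_le: "r_eff k n \<le> real (min k n)"
proof -
  have "real k * real n \<le> real (min k n) * (real k + real n)"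
    by (auto simp: min_def algebra_simps)
  thus ?thesis
    by (cases "k + n = 0") (auto simp: r_eff_def divide_le_eq)
qed

subsection \<open>The joint density of the p-values\<close>

context change_point_model
begin

section \<open>Measurability, and independence of the next smoothing variable from the past\<close>

declare One_nat_def [simp del]

lemma measurable_X [measurable]: "1 \<le> t \<Longrightarrow> random_variable borel (X t)"
  using indep unfolding indep_vars_def by (metis (no_types, lifting) UnI1 atLeast_iff image_eqI sum.case(1))

lemma measurable_U [measurable]: "1 \<le> t \<Longrightarrow> random_variable borel (U t)"
  using indep unfolding indep_vars_def by (metis (no_types, lifting) UnI2 atLeast_iff image_eqI sum.case(2))

lemma measurable_pval [measurable]:
  assumes t: "1 \<le> t"
  shows "random_variable borel (pval X U t)"
proof -
  have "(\<lambda>\<omega>. ((\<Sum>r\<in>{1..<t}. of_bool (X r \<omega> > X t \<omega>)) + U t \<omega>) / real t) \<in> borel_measurable M"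
    using t by (intro borel_measurable_divide borel_measurable_add borel_measurable_sum) (auto simp: of_bool_def)
  thus ?thesis
    by (simp add: pval_def[abs_def])
qed

lemma measurable_pvals_before [measurable]:
  "random_variable (\<Pi>\<^sub>M s\<in>{1..<t}. borel) (pvals_before X U t)"
  unfolding pvals_before_def[abs_def] by (intro measurable_restrict measurable_pval) simp

text \<open>The past p-values involve only variables with index below \<open>t\<close>, while
  \<open>U t\<close> is a separate member of the independent family.\<close>

lemma distr_pvals_before_U:
  assumes t: "1 \<le> t"
  shows "distr M (\<Pi>\<^sub>M s\<in>{1..<t}. borel) (pvals_before X U t) \<Otimes>\<^sub>M uniform_measure lborel {0<..<1} =
    distr M ((\<Pi>\<^sub>M s\<in>{1..<t}. borel) \<Otimes>\<^sub>M borel) (\<lambda>\<omega>. (pvals_before X U t \<omega>, U t \<omega>))"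
proof -
  let ?N = "\<Pi>\<^sub>M s\<in>{1..<t}. (borel :: real measure)"
  let ?A = "Inl ` {1..<t} \<union> Inr ` {1..<t} :: (nat + nat) set"
  let ?B = "{Inr t} :: (nat + nat) set"
  let ?MA = "PiM ?A (\<lambda>_. borel :: real measure)" and ?MB = "PiM ?B (\<lambda>_. borel :: real measure)"
  let ?a = "\<lambda>\<omega>. restrict (\<lambda>i. case_sum X U i \<omega>) ?A" and ?b = "\<lambda>\<omega>. restrict (\<lambda>i. case_sum X U i \<omega>) ?B"
  \<comment> \<open>Evaluating the p-value functional at coordinate projections exhibits the past
    p-values as a measurable function of the block \<open>?A\<close>.\<close>
  let ?g = "\<lambda>z. pvals_before (\<lambda>t z. z (Inl t)) (\<lambda>t z. z (Inr t)) t z"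
  let ?h = "\<lambda>z :: nat + nat \<Rightarrow> real. z (Inr t)"
  have "indep_var ?MA ?a ?MB ?b"
    using t by (intro indep_var_restrict[OF indep]) auto
  hence a [measurable]: "?a \<in> M \<rightarrow>\<^sub>M ?MA" and b [measurable]: "?b \<in> M \<rightarrow>\<^sub>M ?MB"
    and joint: "distr M ?MA ?a \<Otimes>\<^sub>M distr M ?MB ?b = distr M (?MA \<Otimes>\<^sub>M ?MB) (\<lambda>\<omega>. (?a \<omega>, ?b \<omega>))"
    unfolding indep_var_distribution_eq by blast+
  have g [measurable]: "?g \<in> ?MA \<rightarrow>\<^sub>M ?N"
    unfolding pvals_before_def[abs_def] pval_def
    by (intro measurable_restrict borel_measurable_divide borel_measurable_add borel_measurable_sum
        borel_measurable_const measurable_compose[OF _ measurable_of_bool]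
        borel_measurable_pred_less measurable_component_singleton) auto
  have h [measurable]: "?h \<in> ?MB \<rightarrow>\<^sub>M borel"
    by (intro measurable_component_singleton) auto
  have g': "?g \<in> distr M ?MA ?a \<rightarrow>\<^sub>M ?N" and h': "?h \<in> distr M ?MB ?b \<rightarrow>\<^sub>M borel"
    using g h by (simp_all only: measurable_distr_eq1)
  have ga: "?g (?a \<omega>) = pvals_before X U t \<omega>" for \<omega>
  proof -
    have "pval (\<lambda>t z. z (Inl t)) (\<lambda>t z. z (Inr t)) s (?a \<omega>) = pval X U s \<omega>" if "s \<in> {1..<t}" for s
      unfolding pval_def using that
      by (intro arg_cong2[where f="(/)"] arg_cong2[where f="(+)"] sum.cong refl) auto
    thus ?thesis
      unfolding pvals_before_def by (intro restrict_ext)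
  qed
  have "uniform_measure lborel {0<..<1} = distr (distr M ?MB ?b) borel ?h"
    using uniform[OF t] by (subst distr_distr[OF h b]) (simp add: comp_def)
  moreover have "distr M ?N (pvals_before X U t) = distr (distr M ?MA ?a) ?N ?g"
    by (subst distr_distr[OF g a]) (simp add: comp_def ga)
  moreover have "prob_space (distr (distr M ?MB ?b) borel ?h)"
    by (intro prob_space.prob_space_distr[OF prob_space_distr] h' b)
  hence "distr (distr M ?MA ?a) ?N ?g \<Otimes>\<^sub>M distr (distr M ?MB ?b) borel ?h =
      distr (distr M ?MA ?a \<Otimes>\<^sub>M distr M ?MB ?b) (?N \<Otimes>\<^sub>M borel) (\<lambda>(z, z'). (?g z, ?h z'))"
    by (intro pair_measure_distr prob_space_imp_sigma_finite g' h')
  moreover have "distr (distr M ?MA ?a \<Otimes>\<^sub>M distr M ?MB ?b) (?N \<Otimes>\<^sub>M borel) (\<lambda>(z, z'). (?g z, ?h z'))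
      = distr M (?N \<Otimes>\<^sub>M borel) (\<lambda>\<omega>. (pvals_before X U t \<omega>, U t \<omega>))"
    unfolding joint by (subst distr_distr) (measurable, simp add: comp_def ga)
  ultimately show ?thesis by simp
qed

text \<open>Conditionally on the past, the next p-value is a shifted and rescaled copy of its uniform
  smoothing variable; there are only countably many shifts, so null sets are preserved.\<close>

lemma absolutely_continuous_pval:
  assumes t: "1 \<le> t"
  shows "absolutely_continuous (distr M (\<Pi>\<^sub>M s\<in>{1..<t}. borel) (pvals_before X U t) \<Otimes>\<^sub>M lborel)
    (distr M ((\<Pi>\<^sub>M s\<in>{1..<t}. borel) \<Otimes>\<^sub>M lborel) (\<lambda>\<omega>. (pvals_before X U t \<omega>, pval X U t \<omega>)))"
  unfolding absolutely_continuous_def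
proof
  let ?N = "\<Pi>\<^sub>M s\<in>{1..<t}. (borel :: real measure)"
  let ?Y = "pvals_before X U t"
  let ?u = "uniform_measure lborel {0<..<1} :: real measure"
  note [measurable] = measurable_U[OF t] measurable_pval[OF t]
  interpret Y: prob_space "distr M ?N ?Y"
    by (intro prob_space_distr measurable_pvals_before)
  interpret u: prob_space ?u
    by (intro prob_space_uniform_measure) auto
  fix C :: "((nat \<Rightarrow> real) \<times> real) set"
  assume "C \<in> null_sets (distr M ?N ?Y \<Otimes>\<^sub>M lborel)"
  hence C [measurable]: "C \<in> sets (?N \<Otimes>\<^sub>M borel)"
    and C0: "C \<in> null_sets (distr M ?N ?Y \<Otimes>\<^sub>M lborel)"
    by (auto simp: null_sets_def cong: sets_pair_measure_cong)
  interpret Yu: pair_sigma_finite "distr M ?N ?Y" ?u ..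
  interpret Yl: pair_sigma_finite "distr M ?N ?Y" "lborel :: real measure" ..
  have "AE z in distr M ?N ?Y \<Otimes>\<^sub>M lborel. z \<notin> C"
    using C0 by (rule AE_not_in)
  hence slice: "AE y in distr M ?N ?Y. AE u in lborel. (y, u) \<notin> C"
    by (rule Yl.AE_pair)
  \<comment> \<open>For a fixed shift, Fubini reduces the claim to slices: affine maps of nonzero
    slope preserve Lebesgue null sets, and the uniform law is absolutely continuous.\<close>
  have shift: "AE \<omega> in M. (?Y \<omega>, real r / real t + 1 / real t * U t \<omega>) \<notin> C" for r
  proof -
    note joint = distr_pvals_before_U[OF t]
    have "AE z in distr M ?N ?Y \<Otimes>\<^sub>M ?u. (fst z, real r / real t + 1 / real t * snd z) \<notin> C"
    proof (rule Yu.AE_pair_measure)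
      show "{z \<in> space (distr M ?N ?Y \<Otimes>\<^sub>M ?u). (fst z, real r / real t + 1 / real t * snd z) \<notin> C}
        \<in> sets (distr M ?N ?Y \<Otimes>\<^sub>M ?u)"
        unfolding joint by measurable
      show "AE y in distr M ?N ?Y. AE u in ?u. (fst (y, u), real r / real t + 1 / real t * snd (y, u)) \<notin> C"
        using slice AE_space
      proof eventually_elim
        case (elim y)
        have "AE u in lborel. (y, real r / real t + 1 / real t * u) \<notin> C"
          using elim t sets_Pair1[OF C, of y]
          by (intro AE_borel_affine[where P="\<lambda>u. (y, u) \<notin> C"]) (auto simp: pred_def vimage_def Compl_eq)
        thus ?case
          by (intro AE_uniform_measureI) auto
      qed
    qed
    thus ?thesis
      unfolding joint by (subst (asm) AE_distr_iff) measurable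
  qed
  \<comment> \<open>The true shift is random and may depend on the past, so all countably many
    shifts are excluded at once.\<close>
  have "AE \<omega> in M. \<forall>r. (?Y \<omega>, real r / real t + 1 / real t * U t \<omega>) \<notin> C"
    unfolding AE_all_countable using shift by blast
  hence "AE \<omega> in M. (?Y \<omega>, pval X U t \<omega>) \<notin> C"
  proof eventually_elim
    case (elim \<omega>)
    have "pval X U t \<omega> = real (card {r\<in>{1..<t}. X r \<omega> > X t \<omega>}) / real t + 1 / real t * U t \<omega>"
      by (simp add: pval_def of_bool_def sum.If_cases Int_def add_divide_distrib)
    thus ?case using elim by simp
  qed
  moreover have Yp: "(\<lambda>\<omega>. (?Y \<omega>, pval X U t \<omega>)) \<in> M \<rightarrow>\<^sub>M ?N \<Otimes>\<^sub>M lborel"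
    by measurable
  moreover have C_lborel: "C \<in> sets (?N \<Otimes>\<^sub>M lborel)"
    using C by (simp cong: sets_pair_measure_cong)
  hence "{z \<in> space (?N \<Otimes>\<^sub>M lborel). z \<notin> C} \<in> sets (?N \<Otimes>\<^sub>M lborel)"
    by measurable
  ultimately have "AE z in distr M (?N \<Otimes>\<^sub>M lborel) (\<lambda>\<omega>. (?Y \<omega>, pval X U t \<omega>)). z \<notin> C"
    by (simp only: AE_distr_iff)
  thus "C \<in> null_sets (distr M (?N \<Otimes>\<^sub>M lborel) (\<lambda>\<omega>. (?Y \<omega>, pval X U t \<omega>)))"
    using C_lborel by (simp only: AE_iff_null_sets sets_distr)
qed

section \<open>Conditional densities and the chain rule\<close>

lemma borel_measurable_pval_density:
  "(\<lambda>(y, u). pval_density M X U t u y) \<in> borel_measurable ((\<Pi>\<^sub>M s\<in>{1..<t}. lborel) \<Otimes>\<^sub>M lborel)"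
proof -
  have "(\<lambda>(y, u). pval_density M X U t u y) =
      RN_deriv (distr M (\<Pi>\<^sub>M s\<in>{1..<t}. borel) (pvals_before X U t) \<Otimes>\<^sub>M lborel)
        (distr M ((\<Pi>\<^sub>M s\<in>{1..<t}. borel) \<Otimes>\<^sub>M lborel) (\<lambda>\<omega>. (pvals_before X U t \<omega>, pval X U t \<omega>)))"
    by (simp add: fun_eq_iff pval_density_def cond_density_def)
  moreover have sets: "sets ((\<Pi>\<^sub>M s\<in>{1..<t}. lborel) \<Otimes>\<^sub>M lborel :: ((nat \<Rightarrow> real) \<times> real) measure) =
      sets (distr M (\<Pi>\<^sub>M s\<in>{1..<t}. borel) (pvals_before X U t) \<Otimes>\<^sub>M lborel)"
    by (intro sets_pair_measure_cong) (simp_all cong: sets_PiM_cong)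
  ultimately show ?thesis
    by (simp only: measurable_cong_sets[OF sets refl] borel_measurable_RN_deriv)
qed

text \<open>Absolute continuity makes the Radon-Nikodym derivative a genuine density; Tonelli then
  separates the past from the new coordinate.\<close>

lemma nn_integral_pval_density:
  assumes t: "1 \<le> t"
    and h: "h \<in> borel_measurable ((\<Pi>\<^sub>M s\<in>{1..<t}. borel) \<Otimes>\<^sub>M lborel)"
  shows "(\<integral>\<^sup>+\<omega>. h (pvals_before X U t \<omega>, pval X U t \<omega>) \<partial>M) =
    (\<integral>\<^sup>+\<omega>. (\<integral>\<^sup>+u. pval_density M X U t u (pvals_before X U t \<omega>) * h (pvals_before X U t \<omega>, u) \<partial>lborel) \<partial>M)"
proof -
  let ?N = "\<Pi>\<^sub>M s\<in>{1..<t}. (borel :: real measure)"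
  let ?Y = "pvals_before X U t"
  let ?P = "distr M ?N ?Y \<Otimes>\<^sub>M (lborel :: real measure)"
  let ?D = "distr M (?N \<Otimes>\<^sub>M lborel) (\<lambda>\<omega>. (?Y \<omega>, pval X U t \<omega>))"
  note [measurable] = measurable_pval[OF t] h
  interpret Y: prob_space "distr M ?N ?Y"
    by (intro prob_space_distr measurable_pvals_before)
  interpret P: pair_sigma_finite "distr M ?N ?Y" "lborel :: real measure" ..
  have sets: "sets ?D = sets ?P"
    by (simp cong: sets_pair_measure_cong)
  have h': "h \<in> borel_measurable ?P" "h \<in> borel_measurable ?D"
    using h by (simp_all cong: measurable_cong_sets sets_pair_measure_cong)
  have "(\<integral>\<^sup>+\<omega>. h (?Y \<omega>, pval X U t \<omega>) \<partial>M) = (\<integral>\<^sup>+z. h z \<partial>?D)"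
    by (subst nn_integral_distr) measurable
  also have "?D = density ?P (RN_deriv ?P ?D)"
    by (rule P.P.density_RN_deriv[OF absolutely_continuous_pval[OF t] sets, symmetric])
  also have "(\<integral>\<^sup>+z. h z \<partial>\<dots>) = (\<integral>\<^sup>+z. RN_deriv ?P ?D z * h z \<partial>?P)"
    using h' by (intro nn_integral_density) auto
  also have "\<dots> = (\<integral>\<^sup>+y. (\<integral>\<^sup>+u. RN_deriv ?P ?D (y, u) * h (y, u) \<partial>lborel) \<partial>distr M ?N ?Y)"
    using h' by (intro lborel.nn_integral_fst[symmetric] borel_measurable_times_ennreal) auto
  also have "\<dots> = (\<integral>\<^sup>+\<omega>. (\<integral>\<^sup>+u. RN_deriv ?P ?D (?Y \<omega>, u) * h (?Y \<omega>, u) \<partial>lborel) \<partial>M)"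
  proof (intro nn_integral_distr lborel.borel_measurable_nn_integral)
    show "(\<lambda>(y, u). RN_deriv ?P ?D (y, u) * h (y, u)) \<in> borel_measurable ?P"
      using h' by (simp add: borel_measurable_times_ennreal)
  qed measurable
  finally show ?thesis
    by (simp add: pval_density_def cond_density_def)
qed

text \<open>The likelihood ratio as a function of the vector of p-values. The range is half open, so
  time t corresponds to \<open>joint_density (Suc t)\<close>.\<close>

definition joint_density :: "nat \<Rightarrow> (nat \<Rightarrow> real) \<Rightarrow> ennreal" where
  "joint_density t y = (\<Prod>s\<in>{1..<t}. pval_density M X U s (y s) (restrict y {1..<s}))"

lemma borel_measurable_joint_density [measurable]:
  "joint_density t \<in> borel_measurable (\<Pi>\<^sub>M s\<in>{1..<t}. lborel)"
  unfolding joint_density_def[abs_def]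
proof (intro borel_measurable_prod_ennreal)
  fix s assume s: "s \<in> {1..<t}"
  have "(\<lambda>y. (restrict y {1..<s}, y s)) \<in> (\<Pi>\<^sub>M s\<in>{1..<t}. lborel) \<rightarrow>\<^sub>M (\<Pi>\<^sub>M s\<in>{1..<s}. lborel) \<Otimes>\<^sub>M (lborel :: real measure)"
    using s by (intro measurable_Pair measurable_restrict measurable_component_singleton) auto
  from measurable_compose[OF this borel_measurable_pval_density[of s]]
  show "(\<lambda>y. pval_density M X U s (y s) (restrict y {1..<s})) \<in> borel_measurable (\<Pi>\<^sub>M s\<in>{1..<t}. lborel)"
    by simp
qed

text \<open>Events about the oracle process thereby become events about the p-values alone, as a
  Neyman-Pearson comparison requires.\<close>

lemma oracle_lr_eq: "oracle_lr M X U t \<omega> = joint_density (Suc t) (pvals_before X U (Suc t) \<omega>)"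
  unfolding oracle_lr_def joint_density_def
proof (intro prod.cong)
  fix s assume s: "s \<in> {1..<Suc t}"
  have "restrict (pvals_before X U (Suc t) \<omega>) {1..<s} = pvals_before X U s \<omega>"
    unfolding pvals_before_def restrict_restrict using s by (intro arg_cong[where f="restrict _"]) auto
  moreover have "pvals_before X U (Suc t) \<omega> s = pval X U s \<omega>"
    unfolding pvals_before_def using s by (rule restrict_apply')
  ultimately show "pval_density M X U s (pval X U s \<omega>) (pvals_before X U s \<omega>) =
    pval_density M X U s (pvals_before X U (Suc t) \<omega> s) (restrict (pvals_before X U (Suc t) \<omega>) {1..<s})"
    by (simp only:)
qed auto

lemma borel_measurable_oracle_lr [measurable]: "oracle_lr M X U t \<in> borel_measurable M"
proof -
  have "pvals_before X U (Suc t) \<in> M \<rightarrow>\<^sub>M (\<Pi>\<^sub>M s\<in>{1..<Suc t}. lborel)"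
    using measurable_pvals_before[of "Suc t"] by (simp cong: measurable_cong_sets sets_PiM_cong)
  from measurable_compose[OF this borel_measurable_joint_density] show ?thesis
    unfolding oracle_lr_eq[abs_def] .
qed

text \<open>The chain rule: the product of conditional densities is the Lebesgue density of the law
  of the p-values. Each induction step splits off the last coordinate.\<close>

lemma nn_integral_pvals_before:
  assumes "1 \<le> t" "h \<in> borel_measurable (\<Pi>\<^sub>M s\<in>{1..<t}. lborel)"
  shows "(\<integral>\<^sup>+\<omega>. h (pvals_before X U t \<omega>) \<partial>M) =
    (\<integral>\<^sup>+y. joint_density t y * h y \<partial>(\<Pi>\<^sub>M s\<in>{1..<t}. lborel))"
  using assms
proof (induction t arbitrary: h rule: nat_induct_at_least)
  case base
  interpret product_sigma_finite "\<lambda>_::nat. lborel :: real measure" ..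
  \<comment> \<open>For t = 1 the history is empty: the product space is a single point of mass 1
    and the density is an empty product.\<close>
  show ?case
    by (simp add: pvals_before_def joint_density_def PiM_empty nn_integral_count_space_finite emeasure_space_1)
next
  case (Suc t)
  interpret product_sigma_finite "\<lambda>_::nat. lborel :: real measure" ..
  let ?L = "\<lambda>t. \<Pi>\<^sub>M s\<in>{1..<t}. (lborel :: real measure)"
  let ?N = "\<Pi>\<^sub>M s\<in>{1..<t}. (borel :: real measure)"
  let ?Y = "pvals_before X U"
  let ?q = "pval_density M X U t"
  have ins: "{1..<Suc t} = insert t {1..<t}"
    using Suc.hyps by auto
  have upd: "(\<lambda>(y, u). y(t := u)) \<in> ?L t \<Otimes>\<^sub>M lborel \<rightarrow>\<^sub>M ?L (Suc t)"
    unfolding ins by measurable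
  have hu: "(\<lambda>(y, u). h (y(t := u))) \<in> borel_measurable (?L t \<Otimes>\<^sub>M lborel)"
    using measurable_compose[OF upd Suc.prems] by (simp only: split_beta')
  have q: "(\<lambda>(y, u). ?q u y * h (y(t := u))) \<in> borel_measurable (?L t \<Otimes>\<^sub>M lborel)"
    using borel_measurable_times_ennreal[OF borel_measurable_pval_density[of t] hu] by (simp only: split_beta')
  have "?Y (Suc t) \<omega> = (?Y t \<omega>)(t := pval X U t \<omega>)" for \<omega>
    using Suc.hyps by (auto simp: pvals_before_def fun_eq_iff restrict_def)
  hence "(\<integral>\<^sup>+\<omega>. h (?Y (Suc t) \<omega>) \<partial>M) = (\<integral>\<^sup>+\<omega>. (\<lambda>(y, u). h (y(t := u))) (?Y t \<omega>, pval X U t \<omega>) \<partial>M)"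
    by simp
  also have "\<dots> = (\<integral>\<^sup>+\<omega>. (\<integral>\<^sup>+u. ?q u (?Y t \<omega>) * h ((?Y t \<omega>)(t := u)) \<partial>lborel) \<partial>M)"
  proof (subst nn_integral_pval_density[OF Suc.hyps])
    show "(\<lambda>(y, u). h (y(t := u))) \<in> borel_measurable (?N \<Otimes>\<^sub>M lborel)"
      using hu by (simp cong: measurable_cong_sets sets_pair_measure_cong sets_PiM_cong)
  qed simp
  \<comment> \<open>The induction hypothesis is applied to the inner integral as a new test function
    of the past, hence the generalization over \<open>h\<close>.\<close>
  also have "\<dots> = (\<integral>\<^sup>+y. joint_density t y * (\<integral>\<^sup>+u. ?q u y * h (y(t := u)) \<partial>lborel) \<partial>?L t)"
    using q by (intro Suc.IH lborel.borel_measurable_nn_integral)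
  also have "\<dots> = (\<integral>\<^sup>+y. (\<integral>\<^sup>+u. joint_density (Suc t) (y(t := u)) * h (y(t := u)) \<partial>lborel) \<partial>?L t)"
  proof (intro nn_integral_cong)
    fix y assume y: "y \<in> space (?L t)"
    \<comment> \<open>Earlier factors see only coordinates before \<open>t\<close>, which the update
      leaves alone; the new factor sees exactly \<open>y\<close>, since \<open>y\<close> is
      extensional.\<close>
    have "joint_density (Suc t) (y(t := u)) = joint_density t y * ?q u y" for u
    proof -
      have "restrict (y(t := u)) {1..<t} = y"
        using y by (auto simp: space_PiM PiE_def extensional_def restrict_def fun_eq_iff)
      moreover have "restrict (y(t := u)) {1..<s} = restrict y {1..<s}" if "s \<in> {1..<t}" for s
        using that by (auto simp: restrict_def fun_eq_iff)
      hence "(\<Prod>s\<in>{1..<t}. pval_density M X U s ((y(t := u)) s) (restrict (y(t := u)) {1..<s})) = joint_density t y"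
        unfolding joint_density_def by (intro prod.cong) auto
      ultimately show ?thesis
        unfolding joint_density_def[of "Suc t"] ins by (simp add: mult.commute)
    qed
    moreover have "(\<lambda>u. ?q u y * h (y(t := u))) \<in> borel_measurable lborel"
      using measurable_compose[OF measurable_Pair1'[OF y] q] by simp
    ultimately show "joint_density t y * (\<integral>\<^sup>+u. ?q u y * h (y(t := u)) \<partial>lborel) =
        (\<integral>\<^sup>+u. joint_density (Suc t) (y(t := u)) * h (y(t := u)) \<partial>lborel)"
      by (simp add: nn_integral_cmult mult.assoc)
  qed
  also have "\<dots> = (\<integral>\<^sup>+y. joint_density (Suc t) y * h y \<partial>?L (Suc t))"
    unfolding ins using Suc.prems borel_measurable_joint_density[of "Suc t"]
    by (intro product_nn_integral_insert[symmetric] borel_measurable_times_ennreal) (auto simp: ins)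
  finally show ?case .
qed

text \<open>Neyman-Pearson: where the likelihood ratio is at most \<open>b\<close>, the law of the p-values has at
  most \<open>b\<close> times the mass of Lebesgue measure.\<close>

lemma emeasure_oracle_lr_le:
  assumes A: "A \<in> sets (\<Pi>\<^sub>M s\<in>{1..<Suc t}. lborel)"
  shows "emeasure M {\<omega>\<in>space M. oracle_lr M X U t \<omega> \<le> b \<and> pvals_before X U (Suc t) \<omega> \<in> A}
           \<le> b * emeasure (\<Pi>\<^sub>M s\<in>{1..<Suc t}. lborel) A"
proof -
  let ?L = "\<Pi>\<^sub>M s\<in>{1..<Suc t}. (lborel :: real measure)"
  let ?Y = "pvals_before X U (Suc t)"
  let ?S = "{y\<in>space ?L. joint_density (Suc t) y \<le> b \<and> y \<in> A}"
  have S: "?S \<in> sets ?L"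
    using A by measurable
  have Y: "?Y \<in> M \<rightarrow>\<^sub>M ?L"
    using measurable_pvals_before[of "Suc t"] by (simp cong: measurable_cong_sets sets_PiM_cong)
  have "emeasure M {\<omega>\<in>space M. oracle_lr M X U t \<omega> \<le> b \<and> ?Y \<omega> \<in> A} = emeasure M (?Y -` ?S \<inter> space M)"
    using measurable_space[OF Y] by (intro arg_cong[where f="emeasure M"]) (auto simp: oracle_lr_eq)
  also have "\<dots> = (\<integral>\<^sup>+\<omega>. indicator ?S (?Y \<omega>) \<partial>M)"
  proof -
    have "(\<integral>\<^sup>+\<omega>. indicator ?S (?Y \<omega>) \<partial>M) = (\<integral>\<^sup>+\<omega>. indicator (?Y -` ?S \<inter> space M) \<omega> \<partial>M)"
      by (intro nn_integral_cong) (simp add: indicator_def)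
    thus ?thesis
      using measurable_sets[OF Y S] by (simp only: nn_integral_indicator)
  qed
  also have "\<dots> = (\<integral>\<^sup>+y. joint_density (Suc t) y * indicator ?S y \<partial>?L)"
    using S by (intro nn_integral_pvals_before) auto
  also have "\<dots> \<le> (\<integral>\<^sup>+y. b * indicator A y \<partial>?L)"
    by (intro nn_integral_mono) (auto simp: indicator_def)
  also have "\<dots> = b * emeasure ?L A"
    using A by (rule nn_integral_cmult_indicator)
  finally show ?thesis .
qed

section \<open>Almost sure order of the observations and location of the p-values\<close>

lemma distr_X_pair:
  assumes st: "1 \<le> s" "1 \<le> t" "s \<noteq> t"
  shows "distr M borel (X s) \<Otimes>\<^sub>M distr M borel (X t) = distr M (borel \<Otimes>\<^sub>M borel) (\<lambda>\<omega>. (X s \<omega>, X t \<omega>))"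
proof -
  let ?A = "{Inl s} :: (nat + nat) set" and ?B = "{Inl t} :: (nat + nat) set"
  have "indep_var (PiM ?A (\<lambda>_. borel)) (\<lambda>\<omega>. restrict (\<lambda>i. case_sum X U i \<omega>) ?A)
        (PiM ?B (\<lambda>_. borel)) (\<lambda>\<omega>. restrict (\<lambda>i. case_sum X U i \<omega>) ?B)"
    using st by (intro indep_var_restrict[OF indep]) auto
  hence "indep_var borel ((\<lambda>z. z (Inl s)) \<circ> (\<lambda>\<omega>. restrict (\<lambda>i. case_sum X U i \<omega>) ?A))
      borel ((\<lambda>z. z (Inl t)) \<circ> (\<lambda>\<omega>. restrict (\<lambda>i. case_sum X U i \<omega>) ?B))"
    by (rule indep_var_compose) (intro measurable_component_singleton; simp)+
  hence "indep_var borel (X s) borel (X t)"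
    by (simp add: comp_def)
  thus ?thesis
    by (simp add: indep_var_distribution_eq)
qed

text \<open>Continuity of the distribution function excludes atoms; by independence,
  \<open>X t\<close> almost surely misses any given value of \<open>X s\<close>.\<close>

lemma AE_X_neq:
  assumes cont: "continuous_distribution F0" "continuous_distribution F1"
    and st: "1 \<le> s" "s < t"
  shows "AE \<omega> in M. X s \<omega> \<noteq> X t \<omega>"
proof -
  note [measurable] = measurable_X[of s] measurable_X[of t]
  let ?F = "distr M borel (X s)" and ?G = "distr M borel (X t)"
  have "continuous_distribution ?G"
    using cont pre_change[of t] post_change[of t] st by (cases "t \<le> \<tau>") auto
  then interpret G: real_distribution ?G
    by (simp add: continuous_distribution_def)
  have G0: "emeasure ?G {x} = 0" for x
    using \<open>continuous_distribution ?G\<close> G.isCont_cdf[of x] 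
    by (simp add: continuous_distribution_def continuous_on_eq_continuous_at G.emeasure_eq_measure)
  interpret F: prob_space ?F
    using st by (intro prob_space_distr) auto
  interpret FG: pair_sigma_finite ?F ?G ..
  have "AE z in ?F \<Otimes>\<^sub>M ?G. fst z \<noteq> snd z"
  proof (rule FG.AE_pair_measure)
    have "{z \<in> space (borel \<Otimes>\<^sub>M borel). fst z \<noteq> (snd z :: real)} \<in> sets (borel \<Otimes>\<^sub>M borel)"
      by measurable
    thus "{z \<in> space (?F \<Otimes>\<^sub>M ?G). fst z \<noteq> snd z} \<in> sets (?F \<Otimes>\<^sub>M ?G)"
      by (simp add: space_pair_measure cong: sets_pair_measure_cong)
    have "AE y in ?G. x \<noteq> y" for x
      using G0[of x] by (intro AE_I[of _ _ "{x}"]) auto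
    thus "AE x in ?F. AE y in ?G. fst (x, y) \<noteq> snd (x, y)"
      by simp
  qed
  thus ?thesis
    using st by (subst (asm) distr_X_pair) (auto simp: AE_distr_iff)
qed

text \<open>Almost surely \<open>U t\<close> lies strictly between 0 and 1, and the number of
  earlier larger observations is the integer that labels the side of the box.\<close>

lemma AE_pvals_in_box:
  "AE \<omega> in M. pvals_before X U (Suc T) \<omega> \<in> pval_box T (\<lambda>t. X t \<omega>)"
proof -
  have "AE \<omega> in M. U t \<omega> \<in> {0<..<1}" if "t \<in> {1..T}" for t
  proof -
    have "AE u in distr M borel (U t). u \<in> {0<..<1}"
      using that by (subst uniform) (auto intro: AE_uniform_measureI)
    thus ?thesis
      using that by (subst (asm) AE_distr_iff) auto
  qed
  hence "AE \<omega> in M. \<forall>t\<in>{1..T}. U t \<omega> \<in> {0<..<1}"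
    by (intro AE_finite_allI) auto
  thus ?thesis
  proof eventually_elim
    case (elim \<omega>)
    have "pval X U t \<omega> = (real (card {r\<in>{1..<t}. X r \<omega> > X t \<omega>}) + U t \<omega>) / real t" for t
      by (simp add: pval_def of_bool_def sum.If_cases Int_def)
    thus ?case
      using elim by (auto simp: pvals_before_def pval_box_def divide_strict_right_mono)
  qed
qed

lemma AE_X_inj_on:
  assumes "continuous_distribution F0" "continuous_distribution F1"
  shows "AE \<omega> in M. inj_on (\<lambda>t. X t \<omega>) {1..T}"
proof -
  have "AE \<omega> in M. \<forall>s\<in>{1..T}. \<forall>t\<in>{1..T}. s < t \<longrightarrow> X s \<omega> \<noteq> X t \<omega>"
    using AE_X_neq[OF assms] by (intro AE_finite_allI) (auto intro: AE_impI)
  thus ?thesis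
    by eventually_elim (auto intro!: linorder_inj_onI)
qed

text \<open>A union over the permutations with high score: each box has Lebesgue mass 1/T!, hence
  contributes at most b/T! where the likelihood ratio is at most b. A count of permutations thus
  yields a bound under the change-point model.\<close>

lemma emeasure_oracle_lr_score_le:
  fixes b c :: real
  assumes cont: "continuous_distribution F0" "continuous_distribution F1"
    and m: "m \<le> k" "k + m \<le> T" and b: "b \<ge> 0"
  shows "emeasure M {\<omega>\<in>space M. oracle_lr M X U T \<omega> \<le> ennreal b \<and> paired_score d k m (\<lambda>t. X t \<omega>) \<ge> c}
    \<le> ennreal (b * real (card {\<sigma>. \<sigma> permutes {1..T} \<and> paired_score d k m \<sigma> \<ge> c}) / fact T)"
proof -
  let ?G = "{\<sigma>. \<sigma> permutes {1..T} \<and> paired_score d k m \<sigma> \<ge> c}"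
  let ?E = "\<lambda>\<sigma>::nat \<Rightarrow> nat. {\<omega>\<in>space M. oracle_lr M X U T \<omega> \<le> ennreal b \<and> pvals_before X U (Suc T) \<omega> \<in> pval_box T \<sigma>}"
  have fin: "finite ?G"
    by (rule finite_subset[OF _ finite_permutations[of "{1..T}"]]) auto
  have E: "?E \<sigma> \<in> sets M" for \<sigma>
  proof -
    have Y: "pvals_before X U (Suc T) \<in> M \<rightarrow>\<^sub>M (\<Pi>\<^sub>M s\<in>{1..<Suc T}. lborel)"
      using measurable_pvals_before[of "Suc T"] by (simp cong: measurable_cong_sets sets_PiM_cong)
    thus ?thesis
      by measurable
  qed
  have "emeasure M {\<omega>\<in>space M. oracle_lr M X U T \<omega> \<le> ennreal b \<and> paired_score d k m (\<lambda>t. X t \<omega>) \<ge> c}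
      \<le> emeasure M (\<Union>\<sigma>\<in>?G. ?E \<sigma>)"
  proof (intro emeasure_mono_AE)
    show "AE \<omega> in M. \<omega> \<in> {\<omega>\<in>space M. oracle_lr M X U T \<omega> \<le> ennreal b \<and> paired_score d k m (\<lambda>t. X t \<omega>) \<ge> c} \<longrightarrow>
        \<omega> \<in> (\<Union>\<sigma>\<in>?G. ?E \<sigma>)"
      using AE_pvals_in_box[of T] AE_X_inj_on[OF cont, of T]
    proof eventually_elim
      case (elim \<omega>)
      let ?\<sigma> = "rank_perm T (\<lambda>t. X t \<omega>)"
      have "?\<sigma> permutes {1..T}"
        by (rule rank_perm_permutes[OF elim(2)])
      moreover have "paired_score d k m ?\<sigma> = paired_score d k m (\<lambda>t. X t \<omega>)"
        by (rule paired_score_rank_perm[OF m])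
      moreover have "pvals_before X U (Suc T) \<omega> \<in> pval_box T ?\<sigma>"
        using elim(1) by (simp only: pval_box_rank_perm)
      ultimately show ?case
        by (intro impI UN_I[of ?\<sigma>]) simp_all
    qed
  qed (use fin E in auto)
  also have "\<dots> \<le> (\<Sum>\<sigma>\<in>?G. emeasure M (?E \<sigma>))"
    using fin E by (intro emeasure_subadditive_finite) auto
  also have "\<dots> \<le> (\<Sum>\<sigma>\<in>?G. ennreal b * ennreal (1 / fact T))"
    by (intro sum_mono order.trans[OF emeasure_oracle_lr_le]) (simp_all only: pval_box_sets emeasure_pval_box order.refl)
  also have "\<dots> = ennreal (b * real (card ?G) / fact T)"
    using b by (simp add: ennreal_of_nat_eq_real_of_nat mult_ac flip: ennreal_mult)
  finally show ?thesis .
qed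

subsection \<open>The test and the error bound\<close>

lemma borel_measurable_paired_score [measurable]:
  "(\<lambda>\<omega>. paired_score d k m (\<lambda>t. X t \<omega>)) \<in> borel_measurable M"
  unfolding paired_score_def
proof (intro borel_measurable_sum)
  fix i assume "i \<in> {1..m}"
  hence [measurable]: "random_variable borel (X i)" "random_variable borel (X (k + i))"
    by simp_all
  show "(\<lambda>\<omega>. if (X i \<omega> > X (k + i) \<omega>) = d then 1 / 2 else - 1 / 2 :: real) \<in> borel_measurable M"
    by measurable
qed

lemma prob_X_greater:
  assumes "1 \<le> s" "s \<le> \<tau>" "\<tau> < t"
  shows "prob {\<omega>\<in>space M. X s \<omega> > X t \<omega>} = theta F0 F1"
proof -
  have [measurable]: "random_variable borel (X s)" "random_variable borel (X t)"
    using assms by simp_all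
  have "F0 \<Otimes>\<^sub>M F1 = distr M (borel \<Otimes>\<^sub>M borel) (\<lambda>\<omega>. (X s \<omega>, X t \<omega>))"
    using distr_X_pair[of s t] pre_change[of s] post_change[of t] assms by simp
  moreover have "{(x, y). x > y} = {z \<in> space (borel \<Otimes>\<^sub>M borel). fst z > (snd z :: real)}"
    by (auto simp: space_pair_measure)
  hence "{(x, y). x > (y :: real)} \<in> sets (borel \<Otimes>\<^sub>M borel)"
    by simp
  ultimately have "theta F0 F1 = prob ((\<lambda>\<omega>. (X s \<omega>, X t \<omega>)) -` {(x, y). x > y} \<inter> space M)"
    unfolding theta_def by (simp only:) (subst measure_distr; measurable)
  thus ?thesis
    by (simp add: vimage_def Int_def conj_commute)
qed

text \<open>Hoeffding's lower tail for independent comparisons; the sign convention given by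
  \<open>d\<close> makes every summand have mean \<delta>.\<close>

lemma prob_paired_score_le:
  assumes m: "1 \<le> m" "m \<le> \<tau>" and \<epsilon>: "\<epsilon> \<ge> 0"
    and \<delta>: "\<delta> = (if d then theta F0 F1 - 1 / 2 else 1 / 2 - theta F0 F1)"
  shows "prob {\<omega>\<in>space M. paired_score d \<tau> m (\<lambda>t. X t \<omega>) \<le> real m * (\<delta> - \<epsilon>)} \<le> exp (- 2 * \<epsilon>\<^sup>2 * real m)"
proof -
  let ?Z = "\<lambda>i \<omega>. if (X i \<omega> > X (\<tau> + i) \<omega>) = d then 1 / 2 else - 1 / 2 :: real"
  let ?K = "\<lambda>i. {Inl i, Inl (\<tau> + i)} :: (nat + nat) set"
  \<comment> \<open>The blocks are disjoint because m \<le> \<tau> keeps the indices i apart from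
    the indices \<tau> + j.\<close>
  have "indep_vars (\<lambda>i. PiM (?K i) (\<lambda>_. borel)) (\<lambda>i \<omega>. restrict (\<lambda>j. case_sum X U j \<omega>) (?K i)) {1..m}"
    by (rule indep_vars_restrict[OF indep]) (use m in \<open>auto simp: disjoint_family_on_def\<close>)
  hence "indep_vars (\<lambda>_. borel) (\<lambda>i \<omega>. (\<lambda>z. if (z (Inl i) > z (Inl (\<tau> + i))) = d then 1 / 2 else - 1 / 2 :: real)
      (restrict (\<lambda>j. case_sum X U j \<omega>) (?K i))) {1..m}"
  proof (rule indep_vars_compose2)
    fix i assume "i \<in> {1..m}"
    have [measurable]: "(\<lambda>z. z (Inl i)) \<in> borel_measurable (PiM (?K i) (\<lambda>_. borel :: real measure))"
      "(\<lambda>z. z (Inl (\<tau> + i))) \<in> borel_measurable (PiM (?K i) (\<lambda>_. borel :: real measure))"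
      by (intro measurable_component_singleton; simp)+
    show "(\<lambda>z. if (z (Inl i) > z (Inl (\<tau> + i))) = d then 1 / 2 else - 1 / 2 :: real)
        \<in> borel_measurable (PiM (?K i) (\<lambda>_. borel :: real measure))"
      by measurable
  qed
  hence indepZ: "indep_vars (\<lambda>_. borel) ?Z {1..m}"
    by simp
  have expZ: "expectation (?Z i) = \<delta>" if i: "i \<in> {1..m}" for i
  proof -
    let ?E = "{\<omega>\<in>space M. X i \<omega> > X (\<tau> + i) \<omega>}"
    have [measurable]: "random_variable borel (X i)" "random_variable borel (X (\<tau> + i))"
      using i by simp_all
    have E: "?E \<in> events"
      by measurable
    have "expectation (?Z i) = expectation (\<lambda>\<omega>. (if d then 1 else - 1) * (indicator ?E \<omega> - 1 / 2))"
      by (intro Bochner_Integration.integral_cong) (auto simp: indicator_def)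
    also have "\<dots> = (if d then 1 else - 1) * (prob ?E - 1 / 2)"
    proof -
      have "expectation (\<lambda>\<omega>. indicator ?E \<omega> - 1 / 2) = expectation (indicator ?E) - expectation (\<lambda>_. 1 / 2 :: real)"
        using E by (intro Bochner_Integration.integral_diff) (auto simp: emeasure_eq_measure)
      thus ?thesis
        using E by (simp add: prob_space)
    qed
    also have "prob ?E = theta F0 F1"
      using i m by (intro prob_X_greater) auto
    finally show ?thesis
      by (simp add: \<delta>)
  qed
  \<comment> \<open>Each summand lies in an interval of length 1, so the squared lengths add up to
    \<open>m\<close>.\<close>
  interpret Hoeffding_ineq M "{1..m}" ?Z "\<lambda>_. - 1 / 2" "\<lambda>_. 1 / 2" "\<Sum>i\<in>{1..m}. expectation (?Z i)"
    by unfold_locales (use indepZ in auto)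
  have mu: "(\<Sum>i\<in>{1..m}. expectation (?Z i)) = real m * \<delta>"
    using expZ by simp
  have "prob {\<omega>\<in>space M. (\<Sum>i\<in>{1..m}. ?Z i \<omega>) \<le> real m * \<delta> - real m * \<epsilon>} \<le> exp (- 2 * (real m * \<epsilon>)\<^sup>2 / real m)"
    using Hoeffding_ineq_le[of "real m * \<epsilon>"] m \<epsilon> unfolding mu by simp
  also have "- 2 * (real m * \<epsilon>)\<^sup>2 / real m = - 2 * \<epsilon>\<^sup>2 * real m"
    using m by (simp add: power2_eq_square)
  finally show ?thesis
    by (simp add: paired_score_def right_diff_distrib)
qed

lemma prob_oracle_lr_le:
  fixes b l :: real
  assumes cont: "continuous_distribution F0" "continuous_distribution F1"
    and tn: "\<tau> \<ge> 1" "n \<ge> 1" and \<Delta>: "\<Delta> = \<bar>theta F0 F1 - 1 / 2\<bar>"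
    and b: "b > 0" and l: "0 < l" "l < 1"
  shows "prob {\<omega>\<in>space M. oracle_lr M X U (\<tau> + n) \<omega> \<le> ennreal b}
    \<le> 2 * exp (l * ln b - c_const l * \<Delta>\<^sup>2 * r_eff \<tau> n)"
proof -
  define T where "T = \<tau> + n"
  define m where "m = min \<tau> n"
  \<comment> \<open>The side of 1/2 on which \<open>theta F0 F1\<close> lies fixes the direction, so
    every comparison has mean \<Delta>.\<close>
  define d where "d \<longleftrightarrow> theta F0 F1 > 1 / 2"
  \<comment> \<open>This threshold equalizes the two error exponents.\<close>
  define a where "a = sqrt l / (sqrt l + sqrt (1 - l))"
  define c where "c = real m * ((1 - a) * \<Delta>)"
  define S where "S \<omega> = paired_score d \<tau> m (\<lambda>t. X t \<omega>)" for \<omega>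
  define L where "L = {\<omega>\<in>space M. oracle_lr M X U T \<omega> \<le> ennreal b}"
  define L1 where "L1 = {\<omega>\<in>space M. oracle_lr M X U T \<omega> \<le> ennreal b \<and> S \<omega> \<ge> c}"
  define L2 where "L2 = {\<omega>\<in>space M. oracle_lr M X U T \<omega> \<le> ennreal b \<and> S \<omega> \<le> c}"
  define K where "K = c_const l * \<Delta>\<^sup>2 * real m"
  have S [measurable]: "S \<in> borel_measurable M"
    unfolding S_def[abs_def] by measurable
  have [measurable]: "L \<in> events" "L1 \<in> events" "L2 \<in> events"
    unfolding L_def L1_def L2_def by measurable
  have m: "1 \<le> m" "m \<le> \<tau>" "\<tau> + m \<le> T"
    using tn by (auto simp: m_def T_def)
  have pos: "sqrt l > 0" "sqrt (1 - l) > 0"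
    using l by auto
  hence sum_pos: "sqrt l + sqrt (1 - l) > 0"
    by linarith
  have a: "0 \<le> a" "a \<le> 1"
    using pos sum_pos by (simp_all add: a_def pos_divide_le_eq)
  have a': "1 - a = sqrt (1 - l) / (sqrt l + sqrt (1 - l))"
    unfolding a_def using sum_pos by (subst diff_divide_eq_iff) auto
  have \<Delta>0: "\<Delta> \<ge> 0"
    by (simp add: \<Delta>)
  \<comment> \<open>The squares of \<open>a\<close> and \<open>1 - a\<close> are l and 1 - l over
    the same denominator, so the cross products agree.\<close>
  have exponents: "(1 - l) * (2 * a\<^sup>2) = c_const l" "l * (2 * (1 - a)\<^sup>2) = c_const l"
    using l by (simp add: a_def c_const_def power_divide) (simp add: l less_imp_le a' c_const_def power_divide)

  \<comment> \<open>For m = 0 the score vanishes, every permutation qualifies, and the bound b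
    remains.\<close>
  have "emeasure M L \<le> ennreal (b * real (card {\<sigma>. \<sigma> permutes {1..T} \<and> paired_score d \<tau> 0 \<sigma> \<ge> 0}) / fact T)"
    using emeasure_oracle_lr_score_le[OF cont, where m=0 and k=\<tau> and T=T and b=b and d=d and c=0] b
    by (simp add: L_def T_def paired_score_def)
  hence PL: "prob L \<le> b"
    using b by (simp add: emeasure_eq_measure paired_score_def card_permutations)
  have "emeasure M L1 \<le> ennreal (b * real (card {\<sigma>. \<sigma> permutes {1..T} \<and> paired_score d \<tau> m \<sigma> \<ge> c}) / fact T)"
    unfolding L1_def S_def using b by (intro emeasure_oracle_lr_score_le[OF cont] m) auto
  hence "prob L1 \<le> b * real (card {\<sigma>. \<sigma> permutes {1..T} \<and> paired_score d \<tau> m \<sigma> \<ge> c}) / fact T"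
    using b by (simp add: emeasure_eq_measure)
  also have "\<dots> \<le> b * (fact T * exp (- 2 * ((1 - a) * \<Delta>)\<^sup>2 * real m)) / fact T"
    unfolding c_def using a \<Delta>0 b
    by (intro divide_right_mono mult_left_mono card_permutations_paired_score_ge m) auto
  finally have PL1: "prob L1 \<le> b * exp (- 2 * ((1 - a) * \<Delta>)\<^sup>2 * real m)"
    by simp
  have "prob L2 \<le> prob {\<omega>\<in>space M. S \<omega> \<le> real m * (\<Delta> - a * \<Delta>)}"
    unfolding L2_def c_def by (intro finite_measure_mono) (auto simp: algebra_simps)
  also have "\<dots> \<le> exp (- 2 * (a * \<Delta>)\<^sup>2 * real m)"
    unfolding S_def using a \<Delta>0 m by (intro prob_paired_score_le) (auto simp: \<Delta> d_def)
  finally have PL2: "prob L2 \<le> exp (- 2 * (a * \<Delta>)\<^sup>2 * real m)" .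

  \<comment> \<open>Weight 1 - l goes to the trivial bound 1 and weight l to
    \<open>PL1\<close>.\<close>
  have "prob L1 \<le> 1 powr (1 - l) * (b * exp (- 2 * ((1 - a) * \<Delta>)\<^sup>2 * real m)) powr l"
    using l PL1 by (intro le_powr_mult_powr) auto
  also have "\<dots> = exp (l * ln b - l * (2 * (1 - a)\<^sup>2) * \<Delta>\<^sup>2 * real m)"
  proof -
    have "l * (ln b - 2 * (e * \<Delta>)\<^sup>2 * real m) = l * ln b - l * (2 * e\<^sup>2) * \<Delta>\<^sup>2 * real m" for e
      by (simp add: algebra_simps)
    thus ?thesis
      using b by (simp add: powr_def ln_mult)
  qed
  finally have Q1: "prob L1 \<le> exp (l * ln b - K)"
    by (simp add: exponents K_def)
  have "prob L2 \<le> prob L"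
    by (intro finite_measure_mono) (auto simp: L_def L2_def)
  \<comment> \<open>Now weight 1 - l goes to Hoeffding's bound and weight l to b, so both pieces
    carry the factor b^l.\<close>
  hence "prob L2 \<le> exp (- 2 * (a * \<Delta>)\<^sup>2 * real m) powr (1 - l) * b powr l"
    using l PL PL2 by (intro le_powr_mult_powr) auto
  also have "\<dots> = exp (l * ln b - (1 - l) * (2 * a\<^sup>2) * \<Delta>\<^sup>2 * real m)"
    using b by (simp add: powr_def algebra_simps flip: exp_add)
  finally have Q2: "prob L2 \<le> exp (l * ln b - K)"
    by (simp add: exponents K_def)

  have "prob L \<le> prob (L1 \<union> L2)"
    by (intro finite_measure_mono) (auto simp: L_def L1_def L2_def)
  also have "\<dots> \<le> prob L1 + prob L2"
    by (intro measure_Un_le) auto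
  also have "\<dots> \<le> 2 * exp (l * ln b - K)"
    using Q1 Q2 by simp
  also have "\<dots> \<le> 2 * exp (l * ln b - c_const l * \<Delta>\<^sup>2 * r_eff \<tau> n)"
  proof -
    have "c_const l \<ge> 0"
      using l by (simp add: c_const_def)
    hence "c_const l * \<Delta>\<^sup>2 * r_eff \<tau> n \<le> K"
      unfolding K_def m_def by (intro mult_left_mono r_eff_le) auto
    thus ?thesis by simp
  qed
  finally show ?thesis
    by (simp only: L_def T_def)
qed

text \<open>A crossing at time \<open>T\<close> itself would already give detection by
  \<open>T\<close>, so survival past \<open>T\<close> is relaxed to one inequality at the final
  time.\<close>

lemma prob_detection_time_gt:
  "prob {\<omega>\<in>space M. detection_time M X U T B \<omega> > enat T} \<le> prob {\<omega>\<in>space M. oracle_lr M X U T \<omega> \<le> ennreal (B T)}"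
  if "T \<ge> 1"
proof (intro finite_measure_mono subsetI)
  fix \<omega> assume *: "\<omega> \<in> {\<omega>\<in>space M. detection_time M X U T B \<omega> > enat T}"
  have "oracle_lr M X U T \<omega> \<le> ennreal (B T)"
  proof (rule ccontr)
    assume "\<not> oracle_lr M X U T \<omega> \<le> ennreal (B T)"
    hence "detection_time M X U T B \<omega> \<le> enat T"
      unfolding detection_time_def using that by (intro Inf_lower) auto
    with * show False by auto
  qed
  with * show "\<omega> \<in> {\<omega>\<in>space M. oracle_lr M X U T \<omega> \<le> ennreal (B T)}"
    by auto
qed measurable

end

theorem theorem4p1:
  fixes M :: "'a measure" and F0 F1 :: "real measure"
    and X U :: "nat \<Rightarrow> 'a \<Rightarrow> real" and B :: "nat \<Rightarrow> real"
    and \<tau> n T :: nat and \<Delta> :: real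
  assumes "\<tau> \<ge> 1" and "n \<ge> 1" and "T = \<tau> + n"
    and "continuous_distribution F0" and "continuous_distribution F1"
    and "change_point_model M F0 F1 \<tau> X U"
    and "\<Delta> = \<bar>theta F0 F1 - 1 / 2\<bar>" and "\<Delta> > 0"
    and "\<And>t. 1 \<le> t \<Longrightarrow> t \<le> T \<Longrightarrow> B t > 0"
  shows "measure M {\<omega> \<in> space M. detection_time M X U T B \<omega> > enat T}
           \<le> (INF l\<in>{0<..<1}. 2 * exp (l * ln (B T) - c_const l * \<Delta>\<^sup>2 * r_eff \<tau> n))
       \<and> measure M {\<omega> \<in> space M. detection_time M X U T B \<omega> > enat T}
           \<le> 2 * B T powr (1 / 2) * exp (- (\<Delta>\<^sup>2 / 4) * (real \<tau> * real n / (real \<tau> + real n)))"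
proof -
  interpret change_point_model M F0 F1 \<tau> X U by fact
  let ?p = "measure M {\<omega> \<in> space M. detection_time M X U T B \<omega> > enat T}"
  have BT: "B T > 0"
    using assms by simp
  have bound: "?p \<le> 2 * exp (l * ln (B T) - c_const l * \<Delta>\<^sup>2 * r_eff \<tau> n)" if "l \<in> {0<..<1}" for l
  proof -
    have "?p \<le> prob {\<omega>\<in>space M. oracle_lr M X U T \<omega> \<le> ennreal (B T)}"
      using assms by (intro prob_detection_time_gt) simp
    also have "\<dots> \<le> 2 * exp (l * ln (B T) - c_const l * \<Delta>\<^sup>2 * r_eff \<tau> n)"
      unfolding \<open>T = \<tau> + n\<close> using assms BT that by (intro prob_oracle_lr_le) auto
    finally show ?thesis .
  qed
  have c_half: "c_const (1 / 2) = 1 / 4"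
    by (simp add: c_const_def power_mult_distrib)
  have "2 * exp (1 / 2 * ln (B T) - c_const (1 / 2) * \<Delta>\<^sup>2 * r_eff \<tau> n) =
      2 * B T powr (1 / 2) * exp (- (\<Delta>\<^sup>2 / 4) * (real \<tau> * real n / (real \<tau> + real n)))"
    unfolding c_half using BT by (simp add: r_eff_def powr_def flip: exp_add)
  \<comment> \<open>The bound for each l passes to the infimum over the nonempty interval; l = 1/2
    gives the second claim.\<close>
  with bound[of "1 / 2"] bound show ?thesis
    by (auto intro!: cINF_greatest)
qed

end
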